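(* Let $k\ge 2$. Then, as formal power series in $t$ with coefficients in $\mathbb{Q}(p,q,r,x)$, $$\sum_{n\ge 0}\frac{t^n}{[n]_{p,q}!}\sum_{(\sigma,w)\in C_k\wr S_n} q^{\mathrm{inv}(\sigma)}p^{\mathrm{coinv}(\sigma)}r^{\|w\|}x^{\mathrm{wris}(\sigma,w)}=\frac{1-x}{1-x+\sum_{n\ge 1}\frac{p^{\binom{n}{2}}((x-1)t)^n}{[n]_{p,q}!}[k]_{r^n}}.$$
   Context: For $k\ge 2$, $n\ge 0$, the wreath product $C_k\wr S_n$ is identified with the set of pairs $(\sigma,w)$ with $\sigma=\sigma_1\cdots\sigma_n\in S_n$ and $w=w_1\cdots w_n\in\{0,1,\dots,k-1\}^n$ (for $n=0$ there is exactly one, empty, element). $\mathrm{inv}(\sigma)=|\{i<j:\sigma_i>\sigma_j\}|$, $\mathrm{coinv}(\sigma)=|\{i<j:\sigma_i<\sigma_j\}|$, $\|w\|=w_1+\cdots+w_n$. The weak rise statistic is $\mathrm{wris}(\sigma,w)=|\{i\in\{1,\dots,n-1\}:\sigma_i<\sigma_{i+1}\text{ and } w_i= w_{i+1}\}|$. $[n]_{p,q}=\frac{p^n-q^n}{p-q}=p^{n-1}+p^{n-2}q+\cdots+q^{n-1}$, $[n]_{p,q}!=[n]_{p,q}\cdots[1]_{p,q}$ (with $[0]_{p,q}!=1$), and $[k]_{r^n}=1+r^n+r^{2n}+\cdots+r^{(k-1)n}$. *)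

theory Defs
  imports
    "HOL-Computational_Algebra.Computational_Algebra"
    "HOL-Combinatorics.Permutations"
    "HOL-Library.FuncSet"
begin

text \<open>
  The field \<open>\<rat>(p,q,r,x)\<close> as the fraction field of \<open>\<rat>[p][q][r][x]\<close>: \<open>p\<close> is the innermost
  indeterminate, \<open>x\<close> the outermost.
\<close>

type_synonym ratfun = "rat poly poly poly poly fract"

definition var_p :: ratfun where "var_p = to_fract [:[:[:[:0, 1:]:]:]:]"
definition var_q :: ratfun where "var_q = to_fract [:[:[:0, 1:]:]:]"
definition var_r :: ratfun where "var_r = to_fract [:[:0, 1:]:]"
definition var_x :: ratfun where "var_x = to_fract [:0, 1:]"

definition pq_nat :: "'a::comm_ring_1 \<Rightarrow> 'a \<Rightarrow> nat \<Rightarrow> 'a" where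
  "pq_nat p q n = (\<Sum>i<n. p ^ (n - 1 - i) * q ^ i)"

definition pq_fact :: "'a::comm_ring_1 \<Rightarrow> 'a \<Rightarrow> nat \<Rightarrow> 'a" where
  "pq_fact p q n = (\<Prod>m=1..n. pq_nat p q m)"

definition q_nat :: "'a::comm_ring_1 \<Rightarrow> nat \<Rightarrow> 'a" where
  "q_nat z k = (\<Sum>i<k. z ^ i)"

lemma pq_nat_eq_divide:
  fixes p q :: "'a::field"
  assumes "p \<noteq> q"
  shows "pq_nat p q n = (p ^ n - q ^ n) / (p - q)"
proof -
  have "p ^ n - q ^ n = (p - q) * (\<Sum>i<n. q ^ (n - Suc i) * p ^ i)"
    by (simp add: diff_power_eq_sum power_diff_sumr2 mult.commute)
  also have "(\<Sum>i<n. q ^ (n - Suc i) * p ^ i) = pq_nat p q n"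
    unfolding pq_nat_def
    by (subst sum.nat_diff_reindex[symmetric]) (auto intro!: sum.cong simp: mult.commute)
  finally show ?thesis
    using assms by simp
qed

lemma var_p_neq_var_q: "var_p \<noteq> var_q"
  by (simp add: var_p_def var_q_def)

text \<open>
  \<open>\<sigma>\<close> and \<open>w\<close> are functions on the positions \<open>1, \<dots>, n\<close>; outside them \<open>\<sigma>\<close> is the identity and
  \<open>w\<close> is \<open>undefined\<close>, so that each element is represented exactly once.
\<close>

definition wreath :: "nat \<Rightarrow> nat \<Rightarrow> ((nat \<Rightarrow> nat) \<times> (nat \<Rightarrow> nat)) set" where
  "wreath k n = {\<sigma>. \<sigma> permutes {1..n}} \<times> ({1..n} \<rightarrow>\<^sub>E {0..<k})"

definition perm_inv :: "nat \<Rightarrow> (nat \<Rightarrow> nat) \<Rightarrow> nat" where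
  "perm_inv n \<sigma> = card {(i, j). i \<in> {1..n} \<and> j \<in> {1..n} \<and> i < j \<and> \<sigma> i > \<sigma> j}"

definition perm_coinv :: "nat \<Rightarrow> (nat \<Rightarrow> nat) \<Rightarrow> nat" where
  "perm_coinv n \<sigma> = card {(i, j). i \<in> {1..n} \<and> j \<in> {1..n} \<and> i < j \<and> \<sigma> i < \<sigma> j}"

definition word_sum :: "nat \<Rightarrow> (nat \<Rightarrow> nat) \<Rightarrow> nat" where
  "word_sum n w = (\<Sum>i=1..n. w i)"

definition wris :: "nat \<Rightarrow> (nat \<Rightarrow> nat) \<Rightarrow> (nat \<Rightarrow> nat) \<Rightarrow> nat" where
  "wris n \<sigma> w = card {i \<in> {1..n - 1}. \<sigma> i < \<sigma> (i + 1) \<and> w i = w (i + 1)}"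

end

theory Submission
  imports Defs
begin

text \<open>
  Writing \<open>x = 1 + (x - 1)\<close> at each weak rise and reading an element of the wreath product from the
  left until the first \<open>1\<close> is chosen splits off an initial increasing run of some length \<open>m \<ge> 1\<close> in
  a single colour. The run contributes \<open>(x - 1)\<^bsup>m - 1\<^esup>\<close> from the choices, \<open>p\<close> to the power
  \<open>m choose 2\<close> from the coinversions and \<open>[k]\<close> at \<open>r\<^sup>m\<close> from the colour, and summing over its set of
  values gives a Gaussian binomial coefficient. After division by the \<open>(p, q)\<close>-factorials the
  resulting recurrence says that the generating function times
  \<open>1 - \<Sum>\<^sub>m (x - 1)\<^bsup>m - 1\<^esup> \<cdots> t\<^sup>m / [m]!\<close> is \<open>1\<close>.
\<close>

section \<open>Gaussian binomial coefficients\<close>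

text \<open>Weight of two distinct values with \<open>a\<close> standing to the left of
  \<open>b\<close>: \<open>q\<close> for an inversion, \<open>p\<close> for a coinversion.\<close>

definition pair_weight :: "'a \<Rightarrow> 'a \<Rightarrow> 'b::linorder \<Rightarrow> 'b \<Rightarrow> 'a" where
  "pair_weight p q a b = (if b < a then q else p)"

text \<open>Joint weight of the pairs between a block with value set \<open>S\<close> and a later
  block with value set \<open>T\<close>. The order inside the blocks does not affect it, so sets
  suffice.\<close>

definition cross_weight :: "'a::comm_ring_1 \<Rightarrow> 'a \<Rightarrow> 'b::linorder set \<Rightarrow> 'b set \<Rightarrow> 'a" where
  "cross_weight p q S T = (\<Prod>a\<in>S. \<Prod>b\<in>T. pair_weight p q a b)"

lemma pq_fact_0 [simp]: "pq_fact p q 0 = 1"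
  by (simp add: pq_fact_def)

lemma pq_fact_Suc: "pq_fact p q (Suc n) = pq_nat p q (Suc n) * pq_fact p q n"
  by (simp add: pq_fact_def mult.commute)

text \<open>Cut the sum at index \<open>a\<close>: the first part has the common factor
  \<open>p ^ b\<close>, the rest \<open>q ^ a\<close>. This drives the Pascal-type induction in
  \<open>gauss_sum_eq\<close>.\<close>

lemma pq_nat_add: "pq_nat p q (a + b) = p ^ b * pq_nat p q a + q ^ a * pq_nat p q b"
proof -
  have "pq_nat p q (a + b) =
      (\<Sum>i<a. p ^ (a + b - 1 - i) * q ^ i) + (\<Sum>i=a..<a+b. p ^ (a + b - 1 - i) * q ^ i)"
    unfolding pq_nat_def by (simp add: lessThan_atLeast0 sum.atLeastLessThan_concat)
  also have "(\<Sum>i<a. p ^ (a + b - 1 - i) * q ^ i) = p ^ b * pq_nat p q a"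
    unfolding pq_nat_def sum_distrib_left
    by (intro sum.cong refl) (auto simp: add.commute simp flip: power_add mult.assoc)
  also have "(\<Sum>i=a..<a+b. p ^ (a + b - 1 - i) * q ^ i) = (\<Sum>i<b. p ^ (b - 1 - i) * q ^ (i + a))"
    using sum.shift_bounds_nat_ivl[of "\<lambda>i. p ^ (a + b - 1 - i) * q ^ i" 0 a b]
    by (simp add: lessThan_atLeast0 add.commute algebra_simps)
  also have "\<dots> = q ^ a * pq_nat p q b"
    unfolding pq_nat_def sum_distrib_left by (intro sum.cong refl) (simp add: power_add ac_simps)
  finally show ?thesis .
qed

lemma cross_weight_insert_max_right:
  assumes "finite T" "b \<notin> T" "\<And>a. a \<in> S \<Longrightarrow> a < b"
  shows "cross_weight p q S (insert b T) = p ^ card S * cross_weight p q S T"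
proof -
  have "cross_weight p q S (insert b T) = (\<Prod>a\<in>S. p * (\<Prod>b\<in>T. pair_weight p q a b))"
    unfolding cross_weight_def using assms
    by (intro prod.cong refl) (auto simp: pair_weight_def dest: less_asym)
  then show ?thesis
    by (simp add: prod.distrib cross_weight_def)
qed

lemma cross_weight_insert_max_left:
  assumes "finite S" "b \<notin> S" "\<And>a. a \<in> T \<Longrightarrow> a < b"
  shows "cross_weight p q (insert b S) T = q ^ card T * cross_weight p q S T"
proof -
  have "(\<Prod>a\<in>T. pair_weight p q b a) = (\<Prod>a\<in>T. q)"
    using assms by (intro prod.cong refl) (auto simp: pair_weight_def)
  then show ?thesis
    using assms by (simp add: cross_weight_def)
qed

text \<open>The \<open>(p, q)\<close>-Gaussian binomial coefficient, as a sum over the possible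
  value sets of a first block of length \<open>m\<close>.\<close>

definition gauss_sum :: "'a::comm_ring_1 \<Rightarrow> 'a \<Rightarrow> 'b::linorder set \<Rightarrow> nat \<Rightarrow> 'a" where
  "gauss_sum p q V m = (\<Sum>S | S \<subseteq> V \<and> card S = m. cross_weight p q S (V - S))"

lemma gauss_sum_0 [simp]:
  assumes "finite V"
  shows "gauss_sum p q V 0 = 1"
proof -
  have "{S. S \<subseteq> V \<and> card S = 0} = {{}}"
    using assms by (auto dest: finite_subset)
  then show ?thesis
    by (simp add: gauss_sum_def cross_weight_def)
qed

lemma gauss_sum_card [simp]:
  assumes "finite V"
  shows "gauss_sum p q V (card V) = 1"
proof -
  have "{S. S \<subseteq> V \<and> card S = card V} = {V}"
    using assms by (auto dest: card_subset_eq)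
  then show ?thesis
    by (simp add: gauss_sum_def cross_weight_def)
qed

text \<open>Pascal recurrence, by whether the maximum \<open>b\<close> lies in \<open>S\<close>. If
  not, it forms coinversions with all \<open>m + 1\<close> elements of \<open>S\<close>; if so,
  inversions with all \<open>card A - m\<close> elements of the complement.\<close>

lemma gauss_sum_insert_max:
  assumes "finite A" "\<And>a. a \<in> A \<Longrightarrow> a < b"
  shows "gauss_sum p q (insert b A) (Suc m) =
    p ^ Suc m * gauss_sum p q A (Suc m) + q ^ (card A - m) * gauss_sum p q A m"
proof -
  have b: "b \<notin> A"
    using assms(2) by blast
  have fin: "finite S" if "S \<subseteq> A" for S
    using that assms(1) finite_subset by blast
  have "{S. S \<subseteq> insert b A \<and> card S = Suc m} =
      {S. S \<subseteq> A \<and> card S = Suc m} \<union> insert b ` {S. S \<subseteq> A \<and> card S = m}" (is "_ = ?X \<union> ?Y")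
  proof (intro equalityI subsetI)
    fix S assume S: "S \<in> {S. S \<subseteq> insert b A \<and> card S = Suc m}"
    then have "finite S"
      using assms(1) finite_subset by auto
    show "S \<in> ?X \<union> ?Y"
    proof (cases "b \<in> S")
      case True
      then have "S = insert b (S - {b})" "S - {b} \<subseteq> A" "card (S - {b}) = m"
        using S \<open>finite S\<close> by auto
      then show ?thesis by blast
    qed (use S in auto)
  qed (use b fin in \<open>auto simp: card_insert_if\<close>)
  moreover have "?X \<inter> ?Y = {}"
    using b by auto
  moreover have "finite ?X" "finite ?Y"
    using assms(1) by auto
  ultimately have "gauss_sum p q (insert b A) (Suc m) =
      (\<Sum>S\<in>?X. cross_weight p q S (insert b A - S)) + (\<Sum>S\<in>?Y. cross_weight p q S (insert b A - S))"
    unfolding gauss_sum_def by (simp add: sum.union_disjoint)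
  also have "(\<Sum>S\<in>?X. cross_weight p q S (insert b A - S)) =
      (\<Sum>S\<in>?X. p ^ Suc m * cross_weight p q S (A - S))"
  proof (intro sum.cong refl)
    fix S assume S: "S \<in> ?X"
    then have "insert b A - S = insert b (A - S)"
      using b by auto
    then show "cross_weight p q S (insert b A - S) = p ^ Suc m * cross_weight p q S (A - S)"
      using cross_weight_insert_max_right[of "A - S" b S p q] S assms b by auto
  qed
  also have "(\<Sum>S\<in>?Y. cross_weight p q S (insert b A - S)) =
      (\<Sum>S | S \<subseteq> A \<and> card S = m. cross_weight p q (insert b S) (insert b A - insert b S))"
    using b by (intro sum.reindex_cong[where l = "insert b"]) (auto simp: inj_on_def)
  also have "\<dots> = (\<Sum>S | S \<subseteq> A \<and> card S = m. q ^ (card A - m) * cross_weight p q S (A - S))"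
  proof (intro sum.cong refl)
    fix S assume S: "S \<in> {S. S \<subseteq> A \<and> card S = m}"
    then have "insert b A - insert b S = A - S" "card (A - S) = card A - m"
      using b fin by (auto simp: card_Diff_subset)
    then show "cross_weight p q (insert b S) (insert b A - insert b S) =
        q ^ (card A - m) * cross_weight p q S (A - S)"
      using cross_weight_insert_max_left[of S b "A - S" p q] S assms b fin by auto
  qed
  finally show ?thesis
    by (simp add: gauss_sum_def sum_distrib_left)
qed

text \<open>Induction by adjoining a new maximum. With the denominators cleared, the factorial
  formula makes sense in every commutative ring.\<close>

lemma gauss_sum_eq:
  fixes V :: "'b::linorder set"
  assumes "finite V" "m \<le> card V"
  shows "gauss_sum p q V m * (pq_fact p q m * pq_fact p q (card V - m)) = pq_fact p q (card V)"
  using assms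
proof (induction V arbitrary: m rule: finite_linorder_max_induct)
  case empty
  then show ?case by simp
next
  case (insert b A)
  then have b: "b \<notin> A" by blast
  then have card: "card (insert b A) = Suc (card A)"
    using insert by simp
  show ?case
  proof (cases m)
    case 0
    then show ?thesis using insert by simp
  next
    case (Suc l)
    show ?thesis
    \<comment> \<open>Here \<open>m\<close> is the full cardinality, and \<open>Suc l\<close> lies
      outside the range of the induction hypothesis for \<open>A\<close>.\<close>
    proof (cases "l = card A")
      case True
      then have "m = card (insert b A)" using Suc card by simp
      moreover have "gauss_sum p q (insert b A) (card (insert b A)) = 1"
        using insert.hyps(1) by (intro gauss_sum_card) simp
      ultimately show ?thesis by simp
    next
      case False
      define d where "d = card A - Suc l"
      have d: "card A = Suc l + d"
        using False insert.prems card Suc by (simp add: d_def)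
      have IH1: "gauss_sum p q A (Suc l) * (pq_fact p q (Suc l) * pq_fact p q d) = pq_fact p q (card A)"
        using insert.IH[of "Suc l"] d by simp
      have IH2: "gauss_sum p q A l * (pq_fact p q l * pq_fact p q (Suc d)) = pq_fact p q (card A)"
        using insert.IH[of l] d by simp
      have "gauss_sum p q (insert b A) m * (pq_fact p q m * pq_fact p q (card (insert b A) - m)) =
        (p ^ Suc l * gauss_sum p q A (Suc l) + q ^ Suc d * gauss_sum p q A l) *
          (pq_fact p q (Suc l) * pq_fact p q (Suc d))"
        using gauss_sum_insert_max[of A b p q l] insert.hyps card Suc d by simp
      \<comment> \<open>The top factor is peeled off \<open>pq_fact p q (Suc d)\<close> in the first
        summand and off \<open>pq_fact p q (Suc l)\<close> in the second, so that each matches one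
        induction hypothesis.\<close>
      also have "\<dots> = p ^ Suc l * pq_nat p q (Suc d) *
            (gauss_sum p q A (Suc l) * (pq_fact p q (Suc l) * pq_fact p q d)) +
          q ^ Suc d * pq_nat p q (Suc l) *
            (gauss_sum p q A l * (pq_fact p q l * pq_fact p q (Suc d)))"
        unfolding pq_fact_Suc by (simp only: algebra_simps)
      also have "\<dots> = (p ^ Suc l * pq_nat p q (Suc d) + q ^ Suc d * pq_nat p q (Suc l)) *
          pq_fact p q (card A)"
        unfolding IH1 IH2 by (simp only: algebra_simps)
      also have "\<dots> = pq_fact p q (card (insert b A))"
        unfolding card pq_fact_Suc pq_nat_add[symmetric] using d by (simp add: add.commute)
      finally show ?thesis .
    qed
  qed
qed

section \<open>Coloured words\<close>

text \<open>For a word with distinct letters: \<open>q\<close> to the number of inversions times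
  \<open>p\<close> to the number of coinversions. The tail enters only as a set, which suits
  \<open>cross_weight\<close>.\<close>

fun inv_weight :: "'a::comm_ring_1 \<Rightarrow> 'a \<Rightarrow> 'b::linorder list \<Rightarrow> 'a" where
  "inv_weight p q [] = 1"
| "inv_weight p q (a # as) = (\<Prod>b\<in>set as. pair_weight p q a b) * inv_weight p q as"

lemma inv_weight_append:
  assumes "distinct (us @ vs)"
  shows "inv_weight p q (us @ vs) =
    inv_weight p q us * cross_weight p q (set us) (set vs) * inv_weight p q vs"
  using assms
  by (induction us) (simp_all add: cross_weight_def prod.union_disjoint ac_simps)

lemma inv_weight_sorted:
  assumes "sorted_wrt (<) us"
  shows "inv_weight p q us = p ^ (length us choose 2)"
  using assms
proof (induction us)
  case (Cons a us)
  then have "distinct us"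
    by (simp add: strict_sorted_iff)
  have "(\<Prod>b\<in>set us. pair_weight p q a b) = (\<Prod>b\<in>set us. p)"
    using Cons.prems by (intro prod.cong refl) (auto simp: pair_weight_def)
  also have "\<dots> = p ^ length us"
    using \<open>distinct us\<close> by (simp add: distinct_card)
  finally show ?case
    using Cons by (simp add: numeral_2_eq_2 power_add)
qed (simp add: numeral_2_eq_2)

section \<open>Weak rises and the expansion of \<open>x\<close> to their number\<close>

definition weak_rise :: "'b::linorder \<times> nat \<Rightarrow> 'b \<times> nat \<Rightarrow> bool" where
  "weak_rise y z \<longleftrightarrow> fst y < fst z \<and> snd y = snd z"

fun weak_rises :: "('b::linorder \<times> nat) list \<Rightarrow> nat" where
  "weak_rises [] = 0"
| "weak_rises [z] = 0"
| "weak_rises (y # z # zs) = (if weak_rise y z then 1 else 0) + weak_rises (z # zs)"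

lemma weak_rises_snoc:
  "weak_rises (zs @ [z]) = weak_rises zs + (if zs \<noteq> [] \<and> weak_rise (last zs) z then 1 else 0)"
  by (induction zs rule: weak_rises.induct) auto

text \<open>Here \<open>m\<close> is the length of the prefix before the first cut. Each of its
  \<open>m - 1\<close> inner adjacencies must be a weak rise and contributes \<open>x - 1\<close>;
  the cut itself contributes \<open>1\<close>, whether or not there is a weak rise at it.\<close>

lemma power_weak_rises:
  fixes x :: "'a::comm_ring_1" and zs :: "('b::linorder \<times> nat) list"
  assumes "zs \<noteq> []"
  shows "x ^ weak_rises zs = (\<Sum>m=1..length zs.
    if successively weak_rise (take m zs) then (x - 1) ^ (m - 1) * x ^ weak_rises (drop m zs) else 0)"
  using assms
proof (induction zs rule: weak_rises.induct)
  case (3 y z zs)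
  define f where "f = (\<lambda>(zs :: ('b \<times> nat) list) m. if successively weak_rise (take m zs)
    then (x - 1) ^ (m - 1) * x ^ weak_rises (drop m zs) else 0)"
  have IH: "x ^ weak_rises (z # zs) = (\<Sum>m=1..length (z # zs). f (z # zs) m)"
    using 3 by (simp add: f_def)
  \<comment> \<open>A prefix of length at least 2 first uses the adjacency of \<open>y\<close> and
    \<open>z\<close>. Because \<open>m\<close> is at least 1, the exponent \<open>m - 1\<close> is
    not truncated.\<close>
  have step: "f (y # z # zs) (Suc m) = (if weak_rise y z then (x - 1) * f (z # zs) m else 0)"
    if "m \<in> {1..length (z # zs)}" for m
    using that by (cases m) (auto simp: f_def)
  have "(\<Sum>m=1..length (y # z # zs). f (y # z # zs) m) =
      f (y # z # zs) 1 + (\<Sum>m=1..length (z # zs). f (y # z # zs) (Suc m))"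
    by (simp add: sum.atLeast_Suc_atMost sum.shift_bounds_cl_Suc_ivl del: sum.cl_ivl_Suc)
  also have "(\<Sum>m=1..length (z # zs). f (y # z # zs) (Suc m)) =
      (\<Sum>m=1..length (z # zs). if weak_rise y z then (x - 1) * f (z # zs) m else 0)"
    using step by (intro sum.cong refl)
  also have "\<dots> = (if weak_rise y z then (x - 1) * x ^ weak_rises (z # zs) else 0)"
    unfolding IH by (simp add: sum_distrib_left del: sum.cl_ivl_Suc)
  also have "f (y # z # zs) 1 + \<dots> = x ^ weak_rises (y # z # zs)"
    by (simp add: f_def algebra_simps)
  finally show ?case
    by (simp add: f_def)
qed simp_all

text \<open>One-line notation with colours, over an arbitrary value set \<open>V\<close>: removing a
  prefix then leaves a word of the same kind.\<close>

definition coloured_words :: "nat \<Rightarrow> 'b set \<Rightarrow> ('b \<times> nat) list set" where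
  "coloured_words k V =
    {zs. distinct (map fst zs) \<and> fst ` set zs = V \<and> snd ` set zs \<subseteq> {..<k}}"

lemma length_coloured_word: "zs \<in> coloured_words k V \<Longrightarrow> length zs = card V"
  unfolding coloured_words_def using distinct_card[of "map fst zs"] by auto

lemma finite_coloured_words:
  assumes "finite V"
  shows "finite (coloured_words k V)"
proof (rule finite_subset)
  show "coloured_words k V \<subseteq> {zs. set zs \<subseteq> V \<times> {..<k} \<and> length zs = card V}"
  proof
    fix zs assume zs: "zs \<in> coloured_words k V"
    then have "fst z \<in> V \<and> snd z < k" if "z \<in> set zs" for z
      using that by (auto simp: coloured_words_def)
    then show "zs \<in> {zs. set zs \<subseteq> V \<times> {..<k} \<and> length zs = card V}"
      using length_coloured_word[OF zs] by (auto simp: subset_iff mem_Times_iff)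
  qed
  show "finite {zs. set zs \<subseteq> V \<times> {..<k} \<and> length zs = card V}"
    using assms by (intro finite_lists_length_eq) simp
qed

definition colour_weight :: "'a::comm_ring_1 \<Rightarrow> 'a \<Rightarrow> 'a \<Rightarrow> ('b::linorder \<times> nat) list \<Rightarrow> 'a" where
  "colour_weight p q r zs = inv_weight p q (map fst zs) * r ^ sum_list (map snd zs)"

definition wris_sum :: "'a::comm_ring_1 \<Rightarrow> 'a \<Rightarrow> 'a \<Rightarrow> 'a \<Rightarrow> nat \<Rightarrow> 'b::linorder set \<Rightarrow> 'a" where
  "wris_sum p q r x k V = (\<Sum>zs\<in>coloured_words k V. colour_weight p q r zs * x ^ weak_rises zs)"

section \<open>Splitting off an initial rising run\<close>

definition rising_run :: "'b::linorder set \<Rightarrow> nat \<Rightarrow> ('b \<times> nat) list" where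
  "rising_run S c = map (\<lambda>a. (a, c)) (sorted_list_of_set S)"

lemma rising_run_simps [simp]:
  assumes "finite S"
  shows "length (rising_run S c) = card S" "map fst (rising_run S c) = sorted_list_of_set S"
    "fst ` set (rising_run S c) = S" "snd ` set (rising_run S c) \<subseteq> {c}"
    "sum_list (map snd (rising_run S c)) = card S * c"
  using assms by (auto simp: rising_run_def comp_def image_image sum_list_triv)

lemma transp_weak_rise: "transp weak_rise"
  by (auto simp: transp_def weak_rise_def)

lemma successively_weak_rise_rising_run: "successively weak_rise (rising_run S c)"
proof -
  have "sorted_wrt weak_rise (rising_run S c)"
    using strict_sorted_list_of_set[of S] by (simp add: rising_run_def sorted_wrt_map weak_rise_def)
  then show ?thesis
    by (simp add: successively_conv_sorted_wrt transp_weak_rise)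
qed

text \<open>By transitivity of \<open>weak_rise\<close> the word is strictly increasing in its
  values and has one colour. A strictly increasing list is determined by its set, and the head shows
  the colour.\<close>

lemma successively_weak_rise_imp_rising_run:
  assumes "successively weak_rise us" "us \<noteq> []"
  shows "us = rising_run (fst ` set us) (snd (hd us))"
proof -
  have sorted: "sorted_wrt weak_rise us"
    using assms by (simp add: successively_conv_sorted_wrt transp_weak_rise)
  then have "sorted_wrt (<) (map fst us)"
    unfolding sorted_wrt_map by (rule sorted_wrt_mono_rel[rotated]) (simp add: weak_rise_def)
  then have fst: "sorted_list_of_set (fst ` set us) = map fst us"
    using sorted_list_of_set.idem_if_sorted_distinct[of "map fst us"] by (simp add: strict_sorted_iff)
  have "snd z = snd (hd us)" if "z \<in> set us" for z
    using that sorted assms(2) by (cases us) (auto simp: weak_rise_def)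
  then have "map (\<lambda>z. (fst z, snd (hd us))) us = us"
    by (intro map_idI) (metis prod.collapse)
  then show ?thesis
    by (simp add: rising_run_def fst comp_def)
qed

text \<open>A run is determined by its value set and colour, and the remainder is arbitrary: the run
  need not be maximal, so nothing is required where the two parts meet.\<close>

lemma bij_betw_split_rising_run:
  assumes "finite V" "1 \<le> m" "m \<le> card V"
  shows "bij_betw (\<lambda>((S, c), vs). rising_run S c @ vs)
    (SIGMA (S, c):{S. S \<subseteq> V \<and> card S = m} \<times> {..<k}. coloured_words k (V - S))
    {zs \<in> coloured_words k V. successively weak_rise (take m zs)}"
  (is "bij_betw ?f ?A ?B")
proof -
  have fin: "finite S" if "S \<subseteq> V" for S
    using that assms(1) finite_subset by blast
  \<comment> \<open>Since \<open>m\<close> is at least 1, the run has a head from which its colour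
    can be recovered; injectivity in \<open>c\<close> depends on this.\<close>
  have nonempty: "rising_run S c \<noteq> []" if "S \<subseteq> V" "card S = m" for S c
    using rising_run_simps(1)[OF fin[OF that(1)], of c] that(2) assms(2) by auto
  have "inj_on ?f ?A"
  proof (rule inj_onI)
    fix u u' assume u: "u \<in> ?A" "u' \<in> ?A" and "?f u = ?f u'"
    obtain S c vs S' c' vs' where uu': "u = ((S, c), vs)" "u' = ((S', c'), vs')"
      by (metis surj_pair)
    have *: "S \<subseteq> V" "S' \<subseteq> V" "card S = m" "card S' = m"
      using u by (auto simp: uu')
    have eq: "rising_run S c @ vs = rising_run S' c' @ vs'"
      using \<open>?f u = ?f u'\<close> by (simp add: uu')
    \<comment> \<open>Both runs have length \<open>m\<close>, so equal concatenations split at the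
      same place.\<close>
    have "rising_run S c = rising_run S' c'" "vs = vs'"
      using eq * fin by (auto simp: append_eq_append_conv)
    moreover from this have "S = S'"
      using rising_run_simps(3)[of S c] rising_run_simps(3)[of S' c'] fin * by simp
    moreover have "c = c'"
    proof -
      have "snd (hd (rising_run S c)) = c" "snd (hd (rising_run S' c')) = c'"
        using nonempty[of S c] nonempty[of S' c'] *
        by (auto simp: rising_run_def hd_map)
      then show ?thesis
        using \<open>rising_run S c = rising_run S' c'\<close> by simp
    qed
    ultimately show "u = u'" by (simp add: uu')
  qed
  moreover have "?f u \<in> ?B" if u: "u \<in> ?A" for u
  proof -
    obtain S c vs where uv: "u = ((S, c), vs)"
      by (metis surj_pair)
    have *: "S \<subseteq> V" "card S = m" "c < k" "vs \<in> coloured_words k (V - S)"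
      using u by (auto simp: uv)
    then have "finite S" using fin by blast
    have "rising_run S c @ vs \<in> coloured_words k V"
      using * \<open>finite S\<close> subset_trans[OF rising_run_simps(4)[OF \<open>finite S\<close>, of c], of "{..<k}"]
      by (simp add: coloured_words_def image_Un Un_absorb1)
    moreover have "take m (rising_run S c @ vs) = rising_run S c"
      using \<open>finite S\<close> * by simp
    ultimately show ?thesis
      by (simp add: uv successively_weak_rise_rising_run)
  qed
  moreover have "?B \<subseteq> ?f ` ?A"
  proof
    fix zs assume "zs \<in> ?B"
    then have zs: "zs \<in> coloured_words k V" and run: "successively weak_rise (take m zs)"
      by auto
    define us vs where "us = take m zs" and "vs = drop m zs"
    have split: "zs = us @ vs"
      by (simp add: us_def vs_def)
    have len: "length us = m"
      using length_coloured_word[OF zs] assms(3) by (simp add: us_def)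
    then have "us \<noteq> []" using assms(2) by auto
    define S c where "S = fst ` set us" and "c = snd (hd us)"
    have us: "us = rising_run S c"
      unfolding S_def c_def using run \<open>us \<noteq> []\<close>
      by (intro successively_weak_rise_imp_rising_run) (simp_all add: us_def)
    have "distinct (map fst us)" "S \<subseteq> V" "vs \<in> coloured_words k (V - S)"
      using zs by (auto simp: split S_def coloured_words_def)
    moreover have "card S = m"
      using distinct_card[OF \<open>distinct (map fst us)\<close>] len by (simp add: S_def)
    moreover have "c < k"
      using zs hd_in_set[OF \<open>us \<noteq> []\<close>] by (auto simp: c_def split coloured_words_def)
    ultimately have "((S, c), vs) \<in> ?A" by auto
    moreover have "zs = ?f ((S, c), vs)"
      by (simp add: split us)
    ultimately show "zs \<in> ?f ` ?A" by blast
  qed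
  ultimately show ?thesis
    unfolding bij_betw_def by blast
qed

text \<open>All pairs inside the run are coinversions, its \<open>card S\<close> letters carry
  colour \<open>c\<close> each, and the pairs between run and remainder give
  \<open>cross_weight\<close>.\<close>

lemma colour_weight_rising_run_append:
  assumes "finite V" "S \<subseteq> V" "vs \<in> coloured_words k (V - S)"
  shows "colour_weight p q r (rising_run S c @ vs) =
    p ^ (card S choose 2) * (r ^ card S) ^ c * cross_weight p q S (V - S) * colour_weight p q r vs"
proof -
  have S: "finite S"
    using assms finite_subset by blast
  have "distinct (sorted_list_of_set S @ map fst vs)"
    using S assms(3) by (auto simp: coloured_words_def)
  from inv_weight_append[OF this, of p q] show ?thesis
    using S assms(3) inv_weight_sorted[OF strict_sorted_list_of_set[of S], of p q]
    by (simp add: colour_weight_def coloured_words_def power_add ac_simps flip: power_mult)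
qed

text \<open>Expand each power of \<open>x\<close> by \<open>power_weak_rises\<close>, sum over the
  prefix length \<open>m\<close> first, and split each word into run and remainder by the bijection
  above.\<close>

lemma wris_sum_rec:
  assumes "finite V" "V \<noteq> {}"
  shows "wris_sum p q r x k V = (\<Sum>m=1..card V. (x - 1) ^ (m - 1) * p ^ (m choose 2) * q_nat (r ^ m) k *
    (\<Sum>S | S \<subseteq> V \<and> card S = m. cross_weight p q S (V - S) * wris_sum p q r x k (V - S)))"
proof -
  have fin: "finite (coloured_words k (V - S))" for S
    using assms(1) by (intro finite_coloured_words) simp
  have "wris_sum p q r x k V = (\<Sum>zs\<in>coloured_words k V. \<Sum>m=1..card V.
      if successively weak_rise (take m zs)
      then (x - 1) ^ (m - 1) * (colour_weight p q r zs * x ^ weak_rises (drop m zs)) else 0)"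
    unfolding wris_sum_def
  proof (intro sum.cong refl)
    fix zs assume "zs \<in> coloured_words k V"
    then have len: "length zs = card V" by (rule length_coloured_word)
    with assms have "zs \<noteq> []" by auto
    show "colour_weight p q r zs * x ^ weak_rises zs = (\<Sum>m=1..card V.
      if successively weak_rise (take m zs)
      then (x - 1) ^ (m - 1) * (colour_weight p q r zs * x ^ weak_rises (drop m zs)) else 0)"
      unfolding power_weak_rises[OF \<open>zs \<noteq> []\<close>, of x] len sum_distrib_left
      by (intro sum.cong refl) (simp add: ac_simps)
  qed
  also have "\<dots> = (\<Sum>m=1..card V. (x - 1) ^ (m - 1) *
      (\<Sum>zs\<in>{zs \<in> coloured_words k V. successively weak_rise (take m zs)}.
        colour_weight p q r zs * x ^ weak_rises (drop m zs)))"
    \<comment> \<open>After the exchange of sums, the condition on the prefix becomes a restriction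
      of the set of words.\<close>
    by (subst sum.swap) (auto simp: sum_distrib_left sum.inter_filter finite_coloured_words[OF assms(1)] intro!: sum.cong)
  also have "\<dots> = (\<Sum>m=1..card V. (x - 1) ^ (m - 1) * (p ^ (m choose 2) * q_nat (r ^ m) k *
    (\<Sum>S | S \<subseteq> V \<and> card S = m. cross_weight p q S (V - S) * wris_sum p q r x k (V - S))))"
  proof (intro sum.cong refl arg_cong2[of _ _ _ _ "(*)"])
    fix m assume m: "m \<in> {1..card V}"
    let ?I = "{S. S \<subseteq> V \<and> card S = m}"
    let ?A = "SIGMA (S, c):?I \<times> {..<k}. coloured_words k (V - S)"
    let ?f = "\<lambda>((S, c), vs). rising_run S c @ vs"
    let ?g = "\<lambda>zs. colour_weight p q r zs * x ^ weak_rises (drop m zs)"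
    let ?h = "\<lambda>(S, c) vs. p ^ (m choose 2) * (r ^ m) ^ c * cross_weight p q S (V - S) *
          (colour_weight p q r vs * x ^ weak_rises vs)"
    have finI: "finite ?I"
      using assms(1) by simp
    have "sum ?g {zs \<in> coloured_words k V. successively weak_rise (take m zs)} = (\<Sum>y\<in>?A. ?g (?f y))"
      using m assms by (intro sum.reindex_bij_betw[symmetric] bij_betw_split_rising_run) auto
    also have "\<dots> = (\<Sum>(u, vs)\<in>?A. ?h u vs)"
    proof (rule sum.cong[OF refl], clarify)
      fix S c vs
      assume *: "S \<subseteq> V" "m = card S" "vs \<in> coloured_words k (V - S)"
      have "finite S"
        using * assms(1) finite_subset by blast
      then show "colour_weight p q r (rising_run S c @ vs) *
            x ^ weak_rises (drop (card S) (rising_run S c @ vs)) =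
          p ^ (card S choose 2) * (r ^ card S) ^ c * cross_weight p q S (V - S) *
            (colour_weight p q r vs * x ^ weak_rises vs)"
        using colour_weight_rising_run_append[OF assms(1) *(1,3), of p q r c] by (simp add: ac_simps)
    qed
    also have "\<dots> = (\<Sum>u\<in>?I \<times> {..<k}. \<Sum>vs\<in>(case u of (S, c) \<Rightarrow> coloured_words k (V - S)). ?h u vs)"
      using fin finI by (intro sum.Sigma[symmetric]) auto
    also have "\<dots> = (\<Sum>(S, c)\<in>?I \<times> {..<k}.
        p ^ (m choose 2) * (r ^ m) ^ c * (cross_weight p q S (V - S) * wris_sum p q r x k (V - S)))"
      by (intro sum.cong refl) (auto simp: wris_sum_def sum_distrib_left mult.assoc)
    \<comment> \<open>The colour occurs only in \<open>(r ^ m) ^ c\<close>, so the sum over colours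
      is \<open>q_nat (r ^ m) k\<close>.\<close>
    also have "\<dots> = p ^ (m choose 2) * q_nat (r ^ m) k *
        (\<Sum>S\<in>?I. cross_weight p q S (V - S) * wris_sum p q r x k (V - S))"
      unfolding sum.cartesian_product[symmetric] q_nat_def
      by (simp add: sum_distrib_left sum_distrib_right ac_simps)
    finally show "sum ?g {zs \<in> coloured_words k V. successively weak_rise (take m zs)} = \<dots>" .
  qed
  finally show ?thesis by (simp add: mult.assoc)
qed

lemma wris_sum_empty [simp]: "wris_sum p q r x k ({} :: 'b::linorder set) = 1"
proof -
  have "coloured_words k ({} :: 'b set) = {[]}"
    by (auto simp: coloured_words_def)
  then show ?thesis
    by (simp add: wris_sum_def colour_weight_def)
qed

section \<open>The generating function\<close>

text \<open>Compare coefficients in \<open>(1 - B) * inverse (1 - B) = 1\<close>. Since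
  \<open>B\<close> has no constant term, the convolution starts at \<open>m = 1\<close>, as the
  recurrence \<open>wris_sum_rec\<close> does.\<close>

lemma fps_nth_inverse_one_minus:
  fixes B :: "'a::field fps"
  assumes "fps_nth B 0 = 0" "n \<noteq> 0"
  shows "fps_nth (inverse (1 - B)) n = (\<Sum>m=1..n. fps_nth B m * fps_nth (inverse (1 - B)) (n - m))"
proof -
  have "fps_nth ((1 - B) * inverse (1 - B)) n = 0"
    using assms by (simp add: inverse_mult_eq_1')
  then show ?thesis
    using assms by (simp add: left_diff_distrib fps_mult_nth sum.atLeast_Suc_atMost[of 0])
qed

text \<open>Generating function of a single nonempty run, with its \<open>m - 1\<close> factors
  \<open>x - 1\<close>, normalised by the \<open>(p, q)\<close>-factorial.\<close>

definition run_series :: "'a::field \<Rightarrow> 'a \<Rightarrow> 'a \<Rightarrow> 'a \<Rightarrow> nat \<Rightarrow> 'a fps" where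
  "run_series p q r x k = Abs_fps (\<lambda>m. if m \<ge> 1
     then (x - 1) ^ (m - 1) * p ^ (m choose 2) * q_nat (r ^ m) k / pq_fact p q m else 0)"

text \<open>The sum depends on the set of values only through its cardinality, so that no standardization
  of the word left after removing the first run is needed.\<close>

lemma wris_sum_eq_inverse_run_series:
  fixes p q r x :: "'a::field" and V :: "'b::linorder set"
  assumes "\<And>n. pq_fact p q n \<noteq> 0" "finite V"
  shows "wris_sum p q r x k V =
    pq_fact p q (card V) * fps_nth (inverse (1 - run_series p q r x k)) (card V)"
  using assms(2)
proof (induction V rule: finite_psubset_induct)
  case (psubset V)
  define G where "G = inverse (1 - run_series p q r x k)"
  have B0: "fps_nth (run_series p q r x k) 0 = 0"
    by (simp add: run_series_def)
  show ?case
  proof (cases "V = {}")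
    case True
    then show ?thesis using B0 by simp
  next
    case False
    then have "card V \<noteq> 0" using psubset.hyps by simp
    \<comment> \<open>By induction the factor \<open>wris_sum\<close> depends only on
      \<open>card V - m\<close>; it leaves the sum, and what remains is
      \<open>gauss_sum\<close>.\<close>
    have inner: "(\<Sum>S | S \<subseteq> V \<and> card S = m. cross_weight p q S (V - S) * wris_sum p q r x k (V - S)) =
        pq_fact p q (card V) / pq_fact p q m * fps_nth G (card V - m)" if m: "m \<in> {1..card V}" for m
    proof -
      have "(\<Sum>S | S \<subseteq> V \<and> card S = m. cross_weight p q S (V - S) * wris_sum p q r x k (V - S)) =
          (\<Sum>S | S \<subseteq> V \<and> card S = m. cross_weight p q S (V - S) *
            (pq_fact p q (card V - m) * fps_nth G (card V - m)))"
      proof (intro sum.cong refl)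
        fix S assume S: "S \<in> {S. S \<subseteq> V \<and> card S = m}"
        \<comment> \<open>Runs are nonempty, so the remainder uses a proper subset of
          \<open>V\<close> and the induction hypothesis applies.\<close>
        with m have "S \<noteq> {}" by auto
        with S have "V - S \<subset> V" by blast
        moreover have "card (V - S) = card V - m"
          using S psubset.hyps finite_subset by (auto intro: card_Diff_subset)
        ultimately show "cross_weight p q S (V - S) * wris_sum p q r x k (V - S) =
            cross_weight p q S (V - S) * (pq_fact p q (card V - m) * fps_nth G (card V - m))"
          using psubset.IH[of "V - S"] by (simp add: G_def)
      qed
      also have "\<dots> = gauss_sum p q V m * (pq_fact p q (card V - m) * fps_nth G (card V - m))"
        by (simp add: gauss_sum_def sum_distrib_right)
      \<comment> \<open>The factorial of \<open>card V - m\<close> in this denominator cancels the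
        one supplied by the induction hypothesis.\<close>
      also have "gauss_sum p q V m = pq_fact p q (card V) / (pq_fact p q m * pq_fact p q (card V - m))"
        using gauss_sum_eq[of V m p q] psubset.hyps m assms(1) by (simp add: eq_divide_eq)
      finally show ?thesis
        using assms(1) by simp
    qed
    have "wris_sum p q r x k V =
        (\<Sum>m=1..card V. pq_fact p q (card V) * (fps_nth (run_series p q r x k) m * fps_nth G (card V - m)))"
      unfolding wris_sum_rec[OF psubset.hyps False]
      by (intro sum.cong refl, subst inner) (simp_all add: run_series_def)
    also have "\<dots> = pq_fact p q (card V) * fps_nth G (card V)"
      unfolding G_def fps_nth_inverse_one_minus[OF B0 \<open>card V \<noteq> 0\<close>] by (simp add: sum_distrib_left)
    finally show ?thesis by (simp add: G_def)
  qed
qed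

text \<open>The left side is \<open>1 / (1 - run_series p q r x k)\<close>; extending this fraction
  by \<open>1 - x\<close> gives the stated quotient. Any field works in which the factorials do not
  vanish and \<open>x\<close> differs from 1.\<close>

theorem wris_generating_function:
  fixes p q r x :: "'a::field"
  assumes "\<And>n. pq_fact p q n \<noteq> 0" "x \<noteq> 1"
  shows "Abs_fps (\<lambda>n. 1 / pq_fact p q n * wris_sum p q r x k {1..n::nat}) =
    fps_const (1 - x) / (fps_const (1 - x) + Abs_fps (\<lambda>n. if n \<ge> 1
      then p ^ (n choose 2) * (x - 1) ^ n / pq_fact p q n * q_nat (r ^ n) k else 0))"
    (is "?L = _ / (_ + ?E)")
proof -
  let ?D = "1 - run_series p q r x k"
  have "?L = inverse ?D"
    using assms(1) by (simp add: fps_eq_iff wris_sum_eq_inverse_run_series)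
  also have "\<dots> = 1 / ?D"
    by (simp add: fps_divide_unit run_series_def)
  also have "\<dots> = fps_const (1 - x) * 1 / (fps_const (1 - x) * ?D)"
    using assms(2) by (intro div_mult_mult1[symmetric]) simp
  \<comment> \<open>For \<open>n\<close> at least 1, the factor \<open>-(1 - x)\<close> raises
    \<open>(x - 1) ^ (n - 1)\<close> to \<open>(x - 1) ^ n\<close>; the constant term is
    \<open>1 - x\<close>.\<close>
  also have "fps_const (1 - x) * ?D = fps_const (1 - x) + ?E"
  proof (rule fps_ext)
    fix n
    show "fps_nth (fps_const (1 - x) * ?D) n = fps_nth (fps_const (1 - x) + ?E) n"
      by (cases n) (simp_all add: run_series_def algebra_simps diff_divide_distrib)
  qed
  finally show ?thesis by simp
qed

section \<open>From the wreath product to coloured words\<close>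

lemma inv_weight_snoc:
  assumes "distinct (as @ [a])"
  shows "inv_weight p q (as @ [a]) = inv_weight p q as * (\<Prod>b\<in>set as. pair_weight p q b a)"
  using inv_weight_append[OF assms, of p q] by (simp add: cross_weight_def)

text \<open>Separate the pairs whose right end is the new position \<open>Suc n\<close>. With
  \<open>P\<close> left general, this serves both inversions and coinversions.\<close>

lemma card_pairs_Suc:
  "card {(i, j). i \<in> {1..Suc n} \<and> j \<in> {1..Suc n} \<and> i < j \<and> P i j} =
   card {(i, j). i \<in> {1..n} \<and> j \<in> {1..n} \<and> i < j \<and> P i j} + card {i \<in> {1..n}. P i (Suc n)}"
proof -
  let ?X = "{(i, j). i \<in> {1..n} \<and> j \<in> {1..n} \<and> i < j \<and> P i j}"
  let ?Y = "(\<lambda>i. (i, Suc n)) ` {i \<in> {1..n}. P i (Suc n)}"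
  have "{(i, j). i \<in> {1..Suc n} \<and> j \<in> {1..Suc n} \<and> i < j \<and> P i j} = ?X \<union> ?Y"
    by (auto simp: le_Suc_eq)
  moreover have "finite ?X"
    by (rule finite_subset[of _ "{1..n} \<times> {1..n}"]) auto
  moreover have "card ?Y = card {i \<in> {1..n}. P i (Suc n)}"
    by (intro card_image) (auto simp: inj_on_def)
  moreover have "?X \<inter> ?Y = {}"
    by auto
  ultimately show ?thesis
    using card_Un_disjoint[of ?X ?Y] by simp
qed

text \<open>Induction from the right: appending the letter at position \<open>Suc n\<close> adds
  exactly the pairs ending there.\<close>

lemma inv_weight_map_upt:
  assumes "inj_on \<sigma> {1..n}"
  shows "inv_weight p q (map \<sigma> [1..<Suc n]) = q ^ perm_inv n \<sigma> * p ^ perm_coinv n \<sigma>"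
  using assms
proof (induction n)
  case 0
  then show ?case by (simp add: perm_inv_def perm_coinv_def)
next
  case (Suc n)
  have inj: "inj_on \<sigma> {1..n}"
    using Suc.prems by (rule inj_on_subset) auto
  have neq: "\<sigma> i \<noteq> \<sigma> (Suc n)" if "i \<in> {1..n}" for i
    using inj_onD[OF Suc.prems, of i "Suc n"] that by auto
  have split: "[1..<Suc (Suc n)] = [1..<Suc n] @ [Suc n]" by simp
  have set: "set [1..<Suc n] = {1..n}"
    by auto
  have "distinct (map \<sigma> [1..<Suc (Suc n)])"
    using Suc.prems by (subst distinct_map) (auto simp: atLeastLessThanSuc_atLeastAtMost simp del: upt_Suc)
  then have "inv_weight p q (map \<sigma> [1..<Suc (Suc n)]) =
      inv_weight p q (map \<sigma> [1..<Suc n]) * (\<Prod>b\<in>\<sigma> ` {1..n}. pair_weight p q b (\<sigma> (Suc n)))"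
    unfolding split map_append list.map by (subst inv_weight_snoc) (simp_all only: set_map set)
  \<comment> \<open>Distinct values make exactly one of the two conditions true, so
    \<open>pair_weight\<close> factors and the powers of \<open>q\<close> and \<open>p\<close> can
    be counted separately.\<close>
  also have "(\<Prod>b\<in>\<sigma> ` {1..n}. pair_weight p q b (\<sigma> (Suc n))) =
      (\<Prod>i=1..n. (if \<sigma> i > \<sigma> (Suc n) then q else 1) * (if \<sigma> i < \<sigma> (Suc n) then p else 1))"
    unfolding prod.reindex[OF inj] comp_def
  proof (intro prod.cong refl)
    fix i assume "i \<in> {1..n}"
    from neq[OF this] show "pair_weight p q (\<sigma> i) (\<sigma> (Suc n)) =
        (if \<sigma> i > \<sigma> (Suc n) then q else 1) * (if \<sigma> i < \<sigma> (Suc n) then p else 1)"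
      by (auto simp: pair_weight_def)
  qed
  also have "\<dots> = q ^ card {i \<in> {1..n}. \<sigma> i > \<sigma> (Suc n)} * p ^ card {i \<in> {1..n}. \<sigma> i < \<sigma> (Suc n)}"
    by (simp add: prod.distrib prod.If_cases Int_def)
  finally show ?case
    using Suc.IH[OF inj]
      card_pairs_Suc[of n "\<lambda>i j. \<sigma> i > \<sigma> j"] card_pairs_Suc[of n "\<lambda>i j. \<sigma> i < \<sigma> j"]
    unfolding perm_inv_def perm_coinv_def by (simp only: power_add ac_simps)
qed

lemma weak_rises_map_upt: "weak_rises (map (\<lambda>i. (\<sigma> i, w i)) [1..<Suc n]) = wris n \<sigma> w"
proof (induction n)
  case 0
  then show ?case by (simp add: wris_def)
next
  case (Suc n)
  show ?case
  proof (cases n)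
    case 0
    then show ?thesis by (simp add: wris_def)
  next
    case (Suc l)
    \<comment> \<open>For positive \<open>n\<close> the index range gains exactly \<open>n\<close>,
      the comparison of the old last letter with the new one.\<close>
    have "{i \<in> {1..Suc n - 1}. \<sigma> i < \<sigma> (i + 1) \<and> w i = w (i + 1)} =
      {i \<in> {1..n - 1}. \<sigma> i < \<sigma> (i + 1) \<and> w i = w (i + 1)} \<union>
        (if \<sigma> n < \<sigma> (Suc n) \<and> w n = w (Suc n) then {n} else {})"
      using Suc by (auto simp: le_Suc_eq)
    then have "wris (Suc n) \<sigma> w = wris n \<sigma> w + (if \<sigma> n < \<sigma> (Suc n) \<and> w n = w (Suc n) then 1 else 0)"
      unfolding wris_def using Suc by (simp add: card_insert_if)
    moreover have "[1..<Suc (Suc n)] = [1..<Suc n] @ [Suc n]" "last [1..<Suc n] = n" "[1..<Suc n] \<noteq> []"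
      using Suc by auto
    ultimately show ?thesis
      using Suc.IH by (simp add: weak_rises_snoc last_map weak_rise_def del: upt_Suc)
  qed
qed

lemma sum_list_map_upt: "sum_list (map w [1..<Suc n]) = word_sum n w"
  by (simp add: word_sum_def interv_sum_list_conv_sum_set_nat atLeastLessThanSuc_atLeastAtMost del: upt_Suc)

text \<open>One-line notation. Injectivity rests on the fixed values outside the positions: identity
  for the permutation, \<open>undefined\<close> for the colours.\<close>

lemma bij_betw_wreath_coloured_words:
  "bij_betw (\<lambda>(\<sigma>, w). map (\<lambda>i. (\<sigma> i, w i)) [1..<Suc n]) (wreath k n) (coloured_words k {1..n})"
  (is "bij_betw ?f _ _")
proof -
  have set: "set [1..<Suc n] = {1..n}" by auto
  have "inj_on ?f (wreath k n)"
  proof (rule inj_onI, clarify)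
    fix \<sigma> w \<sigma>' w'
    assume *: "(\<sigma>, w) \<in> wreath k n" "(\<sigma>', w') \<in> wreath k n"
      and eq: "map (\<lambda>i. (\<sigma> i, w i)) [1..<Suc n] = map (\<lambda>i. (\<sigma>' i, w' i)) [1..<Suc n]"
    have on: "\<sigma> i = \<sigma>' i \<and> w i = w' i" if "i \<in> {1..n}" for i
      using eq that unfolding map_eq_conv set by auto
    have "\<sigma> = \<sigma>'"
    proof
      fix i show "\<sigma> i = \<sigma>' i"
        using on[of i] * by (cases "i \<in> {1..n}") (auto simp: wreath_def permutes_def)
    qed
    moreover have "w = w'"
      using * on by (intro PiE_ext[of w "{1..n}" "\<lambda>_. {0..<k}" w']) (auto simp: wreath_def)
    ultimately show "\<sigma> = \<sigma>' \<and> w = w'" by simp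
  qed
  moreover have "?f ` wreath k n \<subseteq> coloured_words k {1..n}"
  proof clarify
    fix \<sigma> w assume "(\<sigma>, w) \<in> wreath k n"
    then have \<sigma>: "\<sigma> permutes {1..n}" and w: "\<And>i. i \<in> {1..n} \<Longrightarrow> w i < k"
      by (auto simp: wreath_def PiE_def Pi_def)
    have "inj_on \<sigma> (set [1..<Suc n])" "\<sigma> ` {1..n} = {1..n}"
      using \<sigma> by (auto simp: permutes_image intro: permutes_inj_on)
    moreover have "map fst (map (\<lambda>i. (\<sigma> i, w i)) [1..<Suc n]) = map \<sigma> [1..<Suc n]"
      by (simp del: upt_Suc)
    moreover have "fst ` set (map (\<lambda>i. (\<sigma> i, w i)) [1..<Suc n]) = \<sigma> ` {1..n}"
      "snd ` set (map (\<lambda>i. (\<sigma> i, w i)) [1..<Suc n]) = w ` {1..n}"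
      by (simp_all only: set_map set image_image fst_conv snd_conv)
    ultimately show "map (\<lambda>i. (\<sigma> i, w i)) [1..<Suc n] \<in> coloured_words k {1..n}"
      using w unfolding coloured_words_def mem_Collect_eq by (auto simp only: distinct_map distinct_upt)
  qed
  moreover have "coloured_words k {1..n} \<subseteq> ?f ` wreath k n"
  proof
    fix zs :: "(nat \<times> nat) list" assume zs: "zs \<in> coloured_words k {1..n}"
    have len: "length zs = n"
      using length_coloured_word[OF zs] by simp
    \<comment> \<open>Positions start at 1 and list indices at 0, hence \<open>i - 1\<close>; off
      the positions the identity is what \<open>permutes\<close> demands.\<close>
    define \<sigma> where "\<sigma> = (\<lambda>i. if i \<in> {1..n} then fst (zs ! (i - 1)) else i)"
    define w where "w = (\<lambda>i\<in>{1..n}. snd (zs ! (i - 1)))"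
    have eq: "map (\<lambda>i. (\<sigma> i, w i)) [1..<Suc n] = zs"
      by (rule nth_equalityI) (auto simp: len \<sigma>_def w_def simp del: upt_Suc)
    have "\<sigma> ` {1..n} = fst ` set (map (\<lambda>i. (\<sigma> i, w i)) [1..<Suc n])"
      by (simp only: set_map set image_image fst_conv)
    then have img: "\<sigma> ` {1..n} = {1..n}"
      unfolding eq using zs by (simp add: coloured_words_def)
    \<comment> \<open>A map of a finite set onto itself is injective.\<close>
    then have "bij_betw \<sigma> {1..n} {1..n}"
      by (simp add: bij_betw_def eq_card_imp_inj_on)
    then have "\<sigma> permutes {1..n}"
      by (rule bij_imp_permutes) (auto simp: \<sigma>_def)
    moreover have "w \<in> {1..n} \<rightarrow>\<^sub>E {0..<k}"
    proof
      fix i assume "i \<in> {1..n}"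
      then have "zs ! (i - 1) \<in> set zs"
        by (intro nth_mem) (auto simp: len)
      then show "w i \<in> {0..<k}"
        using zs \<open>i \<in> {1..n}\<close> by (auto simp: w_def coloured_words_def)
    qed (auto simp: w_def)
    ultimately have "(\<sigma>, w) \<in> wreath k n"
      by (simp add: wreath_def)
    with eq show "zs \<in> ?f ` wreath k n" by force
  qed
  ultimately show ?thesis
    by (auto simp: bij_betw_def)
qed

lemma sum_wreath_eq_wris_sum:
  "(\<Sum>(\<sigma>, w)\<in>wreath k n. q ^ perm_inv n \<sigma> * p ^ perm_coinv n \<sigma> * r ^ word_sum n w * x ^ wris n \<sigma> w) =
    wris_sum p q r x k {1..n}"
  unfolding wris_sum_def sum.reindex_bij_betw[OF bij_betw_wreath_coloured_words, symmetric]
proof (rule sum.cong[OF refl], clarify)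
  fix \<sigma> w assume "(\<sigma>, w) \<in> wreath k n"
  then have "inj_on \<sigma> {1..n}"
    by (auto simp: wreath_def intro: permutes_inj_on)
  then show "q ^ perm_inv n \<sigma> * p ^ perm_coinv n \<sigma> * r ^ word_sum n w * x ^ wris n \<sigma> w =
      colour_weight p q r (map (\<lambda>i. (\<sigma> i, w i)) [1..<Suc n]) *
        x ^ weak_rises (map (\<lambda>i. (\<sigma> i, w i)) [1..<Suc n])"
    by (simp only: colour_weight_def map_map comp_def fst_conv snd_conv inv_weight_map_upt
        sum_list_map_upt weak_rises_map_upt)
qed

section \<open>Nonvanishing in the field of rational functions\<close>

lemma to_fract_power: "to_fract (a ^ n) = to_fract a ^ n"
  by (induction n) simp_all

text \<open>A zero would force equal \<open>(n + 1)\<close>-st powers of the indeterminates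
  \<open>p\<close> and \<open>q\<close>; as polynomials in \<open>q\<close> these have degrees 0 and
  \<open>n + 1\<close>.\<close>

lemma pq_nat_var_nonzero: "pq_nat var_p var_q (Suc n) \<noteq> 0"
proof
  assume "pq_nat var_p var_q (Suc n) = 0"
  then have "var_p ^ Suc n = var_q ^ Suc n"
    using var_p_neq_var_q by (simp add: pq_nat_eq_divide[OF var_p_neq_var_q] del: power_Suc)
  then have "[:[:[:[:0, 1:]:]:]:] ^ Suc n = ([:[:[:0, 1:]:]:] :: rat poly poly poly poly) ^ Suc n"
    unfolding var_p_def var_q_def by (simp only: to_fract_power[symmetric] to_fract_eq_iff)
  \<comment> \<open>Both sides are constant in \<open>x\<close> and \<open>r\<close>; removing these
    two layers leaves an equation in polynomials in \<open>q\<close> over polynomials in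
    \<open>p\<close>.\<close>
  then have eq: "[:[:0, 1:]:] ^ Suc n = ([:0, 1:] :: rat poly poly) ^ Suc n"
    by (simp only: poly_const_pow pCons_eq_iff)
  have "degree ([:[:0, 1:]:] ^ Suc n :: rat poly poly) = 0"
    by (simp only: poly_const_pow degree_pCons_0)
  moreover have "degree (([:0, 1:] :: rat poly poly) ^ Suc n) = Suc n"
    by (subst degree_power_eq) simp_all
  ultimately show False
    unfolding eq by simp
qed

lemma pq_fact_var_nonzero: "pq_fact var_p var_q n \<noteq> 0"
  by (induction n) (simp_all add: pq_fact_Suc pq_nat_var_nonzero)

lemma var_x_neq_1: "var_x \<noteq> 1"
proof -
  have "to_fract [:0, 1:] \<noteq> (to_fract 1 :: ratfun)"
    unfolding to_fract_eq_iff by (simp add: one_pCons)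
  then show ?thesis
    by (simp add: var_x_def)
qed

theorem theorem6:
  fixes k :: nat
  assumes "k \<ge> 2"
  shows "Abs_fps (\<lambda>n. 1 / pq_fact var_p var_q n *
             (\<Sum>(\<sigma>, w)\<in>wreath k n.
                var_q ^ perm_inv n \<sigma> * var_p ^ perm_coinv n \<sigma> *
                var_r ^ word_sum n w * var_x ^ wris n \<sigma> w)) =
         fps_const (1 - var_x) /
           (fps_const (1 - var_x) +
             Abs_fps (\<lambda>n. if n \<ge> 1
               then var_p ^ (n choose 2) * (var_x - 1) ^ n / pq_fact var_p var_q n
                      * q_nat (var_r ^ n) k
               else 0))"
  unfolding sum_wreath_eq_wris_sum
  by (rule wris_generating_function[OF pq_fact_var_nonzero var_x_neq_1])

end
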